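(* Let $A=\{0,1,2,3\}$ and let $P_z,P_e$ be integers with $0\le P_z,P_e\le 9$. Then the language-shift cellular automaton $K:A^{\mathbb{Z}^2}\to A^{\mathbb{Z}^2}$ with parameters $(P_z,P_e)$ is almost equicontinuous.
   Context: Let $A=\{0,1,2,3\}$ and let $P_z,P_e$ be integers with $0\le P_z\le 9$ and $0\le P_e\le 9$. For $x\in A^{\mathbb{Z}^2}$ and $(i,j)\in\mathbb{Z}^2$ put $$\Sigma_0(x)_{i,j}=\sum_{r=-1}^{1}\sum_{s=-1}^{1}\left\lfloor \frac{x_{(i+r,j+s)}}{2}\right\rfloor,\qquad \Sigma_1(x)_{i,j}=\sum_{r=-1}^{1}\sum_{s=-1}^{1}\left(x_{(i+r,j+s)}-2\left\lfloor \frac{x_{(i+r,j+s)}}{2}\right\rfloor\right).$$ (So $\Sigma_0$ counts the cells in state $2$ or $3$, and $\Sigma_1$ counts the cells in state $1$ or $3$, in the $3\times 3$ block centered at $(i,j)$, center included.) The language-shift cellular automaton $K$ with parameters $(P_z,P_e)$ is defined, at each $(i,j)\in\mathbb{Z}^2$, by: - if $x_{(i,j)}=0$: $K(x)_{(i,j)}=0$ if $\Sigma_0(x)_{i,j}<P_z$ and $\Sigma_1(x)_{i,j}<P_e$; $=1$ if $\Sigma_0(x)_{i,j}<P_z$ and $\Sigma_1(x)_{i,j}\ge P_e$; $=2$ if $\Sigma_0(x)_{i,j}\ge P_z$ and $\Sigma_1(x)_{i,j}<P_e$; $=3$ if $\Sigma_0(x)_{i,j}\ge P_z$ and $\Sigma_1(x)_{i,j}\ge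 P_e$; - if $x_{(i,j)}=1$: $K(x)_{(i,j)}=3$ if $\Sigma_0(x)_{i,j}\ge P_z$, and $=1$ otherwise; - if $x_{(i,j)}=2$: $K(x)_{(i,j)}=3$ if $\Sigma_1(x)_{i,j}\ge P_e$, and $=2$ otherwise; - if $x_{(i,j)}=3$: $K(x)_{(i,j)}=3$. The space $A^{\mathbb{Z}^2}$ carries the metric $d(x,y)=2^{-\min\{\|v\|_\infty:\ v\in\mathbb{Z}^2,\ x_v\neq y_v\}}$ for $x\ne y$ (and $d(x,x)=0$), where $\|(v_1,v_2)\|_\infty=\max(|v_1|,|v_2|)$; it induces the product topology. A point $x\in A^{\mathbb{Z}^2}$ is a point of equicontinuity of a cellular automaton $F:A^{\mathbb{Z}^2}\to A^{\mathbb{Z}^2}$ if for every $\varepsilon>0$ there is $\delta>0$ such that for all $y$ with $d(x,y)<\delta$ and all $n\in\mathbb{N}$, $d(F^n(x),F^n(y))<\varepsilon$. The automaton $F$ is almost equicontinuous if its set of points of equicontinuity contains a countable intersection of dense open subsets of $A^{\mathbb{Z}^2}$. *)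

theory Defs
  imports "HOL-Analysis.Analysis"
begin

type_synonym config = "int \<times> int \<Rightarrow> int"

definition alphabet :: "int set" where
  "alphabet = {0, 1, 2, 3}"

definition configs :: "config set" where
  "configs = UNIV \<rightarrow> alphabet"

definition Sigma0 :: "config \<Rightarrow> int \<times> int \<Rightarrow> int" where
  "Sigma0 x = (\<lambda>(i, j). \<Sum>r = -1..1. \<Sum>s = -1..1. x (i + r, j + s) div 2)"

definition Sigma1 :: "config \<Rightarrow> int \<times> int \<Rightarrow> int" where
  "Sigma1 x = (\<lambda>(i, j). \<Sum>r = -1..1. \<Sum>s = -1..1. (x (i + r, j + s) - 2 * (x (i + r, j + s) div 2)))"

definition language_shift :: "int \<Rightarrow> int \<Rightarrow> config \<Rightarrow> config" where
  "language_shift Pz Pe x = (\<lambda>v.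
     if x v = 0 then
       (if Sigma0 x v < Pz \<and> Sigma1 x v < Pe then 0
        else if Sigma0 x v < Pz \<and> Sigma1 x v \<ge> Pe then 1
        else if Sigma0 x v \<ge> Pz \<and> Sigma1 x v < Pe then 2
        else 3)
     else if x v = 1 then (if Sigma0 x v \<ge> Pz then 3 else 1)
     else if x v = 2 then (if Sigma1 x v \<ge> Pe then 3 else 2)
     else 3)"

definition sup_norm :: "int \<times> int \<Rightarrow> nat" where
  "sup_norm v = nat (max \<bar>fst v\<bar> \<bar>snd v\<bar>)"

definition cdist :: "config \<Rightarrow> config \<Rightarrow> real" where
  "cdist x y = (if x = y then 0 else 2 powr (- real (LEAST n. \<exists>v. x v \<noteq> y v \<and> n = sup_norm v)))"

lemma cdist_less_iff:
  "cdist x y < 2 powr (- real m) \<longleftrightarrow> (\<forall>v. sup_norm v \<le> m \<longrightarrow> x v = y v)"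
proof (cases "x = y")
  case True
  then show ?thesis by (simp add: cdist_def)
next
  case False
  let ?P = "\<lambda>n. \<exists>v. x v \<noteq> y v \<and> n = sup_norm v"
  define k where "k = Least ?P"
  have d: "cdist x y = 2 powr (- real k)"
    using False by (simp add: cdist_def k_def)
  from False have "\<exists>n. ?P n" by auto
  then have "?P k" unfolding k_def by (rule LeastI_ex)
  then obtain v where v: "x v \<noteq> y v" "k = sup_norm v" by blast
  have low: "k \<le> sup_norm w" if "x w \<noteq> y w" for w
    unfolding k_def by (rule Least_le) (use that in blast)
  have "cdist x y < 2 powr (- real m) \<longleftrightarrow> m < k"
    unfolding d by simp
  also have "\<dots> \<longleftrightarrow> (\<forall>v. sup_norm v \<le> m \<longrightarrow> x v = y v)"
    using v low by (metis leD leI le_less_trans)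
  finally show ?thesis .
qed

lemma cdist_nonneg: "0 \<le> cdist x y"
  by (simp add: cdist_def)

lemma cdist_commute: "cdist x y = cdist y x"
proof -
  have "(\<lambda>n. \<exists>v. x v \<noteq> y v \<and> n = sup_norm v) = (\<lambda>n. \<exists>v. y v \<noteq> x v \<and> n = sup_norm v)"
    by metis
  then show ?thesis
    unfolding cdist_def by (metis (no_types))
qed

lemma cdist_ultra: "cdist x z \<le> max (cdist x y) (cdist y z)"
proof (rule ccontr)
  assume a: "\<not> ?thesis"
  then have ne: "x \<noteq> z"
    using cdist_nonneg[of x y] by (metis cdist_def max.coboundedI1)
  define k where "k = (LEAST n. \<exists>v. x v \<noteq> z v \<and> n = sup_norm v)"
  have k: "cdist x z = 2 powr (- real k)"
    using ne by (simp add: cdist_def k_def)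
  have "cdist x y < 2 powr (- real k)" "cdist y z < 2 powr (- real k)"
    using a k by auto
  then have "cdist x z < 2 powr (- real k)"
    unfolding cdist_less_iff by simp
  with k show False by simp
qed

interpretation configs: Metric_space configs cdist
proof
  fix x y z
  show "0 \<le> cdist x y" by (rule cdist_nonneg)
  show "cdist x y = cdist y x" by (rule cdist_commute)
  show "(cdist x y = 0) = (x = y)" by (simp add: cdist_def)
  show "cdist x z \<le> cdist x y + cdist y z"
    using cdist_ultra[of x z y] cdist_nonneg[of x y] cdist_nonneg[of y z] by linarith
qed

lemma language_shift_configs: "language_shift Pz Pe \<in> configs \<rightarrow> configs"
  by (auto simp: language_shift_def configs_def alphabet_def)

definition equicontinuity_points :: "(config \<Rightarrow> config) \<Rightarrow> config set" where
  "equicontinuity_points F =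
     {x \<in> configs. \<forall>\<epsilon>>0. \<exists>\<delta>>0. \<forall>y\<in>configs. cdist x y < \<delta> \<longrightarrow>
        (\<forall>n. cdist ((F ^^ n) x) ((F ^^ n) y) < \<epsilon>)}"

text \<open>The intersection is taken within \<^term>\<open>configs\<close>, so that the empty family has
  intersection \<^term>\<open>configs\<close>.\<close>

definition almost_equicontinuous :: "(config \<Rightarrow> config) \<Rightarrow> bool" where
  "almost_equicontinuous F \<longleftrightarrow>
     (\<exists>\<U>. countable \<U> \<and>
       (\<forall>U\<in>\<U>. openin configs.mtopology U \<and> configs.mtopology closure_of U = configs) \<and>
       configs \<inter> \<Inter>\<U> \<subseteq> equicontinuity_points F)"

end

theory Submission
  imports Defs
begin

text \<open>State 3 is never left and the neighbourhood has radius 1, so a square ring of 3s shields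
  its interior from the outside forever. Hence a configuration with such rings at arbitrarily large
  radii is a point of equicontinuity. Having a ring of radius at least \<open>n\<close> is an open condition,
  and a dense one, because any finite pattern can be surrounded by a ring.\<close>

definition ring :: "nat \<Rightarrow> config \<Rightarrow> bool" where
  "ring k x \<longleftrightarrow> (\<forall>v. sup_norm v = k \<longrightarrow> x v = 3)"

lemma sup_norm_neighbour:
  assumes "r \<in> {-1..1}" "s \<in> {-1..1}"
  shows "sup_norm (i + r, j + s) \<le> Suc (sup_norm (i, j))"
  using assms by (auto simp: sup_norm_def)

lemma language_shift_local:
  assumes "\<And>r s. r \<in> {-1..1} \<Longrightarrow> s \<in> {-1..1} \<Longrightarrow> x (i + r, j + s) = y (i + r, j + s)"
  shows "language_shift Pz Pe x (i, j) = language_shift Pz Pe y (i, j)"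
proof -
  have "Sigma0 x (i, j) = Sigma0 y (i, j)" "Sigma1 x (i, j) = Sigma1 y (i, j)"
    by (simp_all add: Sigma0_def Sigma1_def assms)
  moreover have "x (i, j) = y (i, j)" using assms[of 0 0] by simp
  ultimately show ?thesis by (simp add: language_shift_def)
qed

lemma language_shift_ring: "ring k x \<Longrightarrow> ring k (language_shift Pz Pe x)"
  by (simp add: ring_def language_shift_def)

text \<open>On the ring itself both images are 3, since 3 is a fixed state. Strictly inside, the
  whole 3 x 3 block stays within radius \<open>k\<close>, where \<open>x\<close> and
  \<open>y\<close> agree.\<close>

lemma ring_shields_step:
  assumes "ring k x" "\<And>v. sup_norm v \<le> k \<Longrightarrow> x v = y v" "sup_norm v \<le> k"
  shows "language_shift Pz Pe x v = language_shift Pz Pe y v"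
proof (cases "sup_norm v = k")
  case True
  \<comment> \<open>The agreement includes the cells of norm exactly \<open>k\<close>, so
    \<open>y\<close> inherits the ring.\<close>
  have "ring k y" using assms(1,2) by (metis order_refl ring_def)
  with assms(1) True show ?thesis by (metis language_shift_ring ring_def)
next
  case False
  obtain i j where v: "v = (i, j)" by force
  have "x (i + r, j + s) = y (i + r, j + s)" if "r \<in> {-1..1}" "s \<in> {-1..1}" for r s
    using False assms(2,3) sup_norm_neighbour[OF that, of i j] v by auto
  then show ?thesis unfolding v by (rule language_shift_local)
qed

text \<open>The ring is carried through the induction because each further step needs it for the
  current iterate of \<open>x\<close>.\<close>

lemma ring_shields:
  assumes "ring k x" "\<And>v. sup_norm v \<le> k \<Longrightarrow> x v = y v"
  shows "ring k ((language_shift Pz Pe ^^ n) x) \<and>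
    (\<forall>v. sup_norm v \<le> k \<longrightarrow> (language_shift Pz Pe ^^ n) x v = (language_shift Pz Pe ^^ n) y v)"
  by (induction n) (use assms ring_shields_step language_shift_ring in auto)

lemma powr_minus_nat_below:
  fixes e :: real
  assumes "e > 0"
  obtains m :: nat where "2 powr (- real m) < e"
proof -
  obtain m where "(1/2) ^ m < e" using real_arch_pow_inv[OF assms, of "1/2"] by auto
  then show thesis
    by (intro that[of m]) (simp add: powr_minus powr_realpow power_one_over inverse_eq_divide)
qed

text \<open>A tolerance \<open>e\<close> only concerns cells of norm at most some \<open>m\<close>.
  A ring of radius \<open>k \<ge> m\<close> protects them at all times, so the distance bound given
  by \<open>k\<close> does not depend on the number of iterations.\<close>

lemma rings_equicontinuity_point:
  assumes "x \<in> configs" "\<And>n. \<exists>k\<ge>n. ring k x"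
  shows "x \<in> equicontinuity_points (language_shift Pz Pe)"
  unfolding equicontinuity_points_def
proof (intro CollectI conjI allI impI)
  fix e :: real assume "e > 0"
  then obtain m :: nat where m: "2 powr (- real m) < e" by (rule powr_minus_nat_below)
  obtain k where k: "k \<ge> m" "ring k x" using assms(2) by blast
  have "cdist ((language_shift Pz Pe ^^ n) x) ((language_shift Pz Pe ^^ n) y) < e"
    if "cdist x y < 2 powr (- real k)" for y n
  proof -
    have "cdist ((language_shift Pz Pe ^^ n) x) ((language_shift Pz Pe ^^ n) y) < 2 powr (- real m)"
      using that k ring_shields[OF k(2), of y] unfolding cdist_less_iff by auto
    with m show ?thesis by linarith
  qed
  then show "\<exists>d>0. \<forall>y\<in>configs. cdist x y < d \<longrightarrow>
      (\<forall>n. cdist ((language_shift Pz Pe ^^ n) x) ((language_shift Pz Pe ^^ n) y) < e)"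
    by (intro exI[of _ "2 powr (- real k)"]) auto
qed (rule assms(1))

text \<open>A ring of radius \<open>k\<close> is a condition on cells of norm \<open>k\<close>
  alone, and closeness below \<open>2 powr (- real k)\<close> fixes those cells.\<close>

lemma openin_rings: "openin configs.mtopology {x \<in> configs. \<exists>k\<ge>n. ring k x}"
  unfolding configs.openin_mtopology
proof (intro conjI ballI allI impI)
  fix x assume "x \<in> {x \<in> configs. \<exists>k\<ge>n. ring k x}"
  then obtain k where k: "k \<ge> n" "ring k x" by blast
  have "ring k y" if "cdist x y < 2 powr (- real k)" for y
    using that k(2) unfolding cdist_less_iff ring_def by (metis order_refl)
  with k(1) show "\<exists>r>0. configs.mball x r \<subseteq> {x \<in> configs. \<exists>k\<ge>n. ring k x}"
    by (intro exI[of _ "2 powr (- real k)"]) (auto simp: configs.in_mball)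
qed auto

lemma dense_rings: "configs.mtopology closure_of {x \<in> configs. \<exists>k\<ge>n. ring k x} = configs"
proof -
  have "\<exists>y\<in>{x \<in> configs. \<exists>k\<ge>n. ring k x}. y \<in> configs.mball x e" if x: "x \<in> configs" and e: "e > 0" for x e
  proof -
    obtain m :: nat where m: "2 powr (- real m) < e" by (rule powr_minus_nat_below[OF e])
    \<comment> \<open>\<open>Suc m\<close> places the ring outside the cells of norm at most
      \<open>m\<close>, so overwriting it keeps \<open>y\<close> in the ball; \<open>n\<close> makes
      its radius large enough.\<close>
    define k where "k = max n (Suc m)"
    define y where "y v = (if sup_norm v = k then 3 else x v)" for v
    have "y \<in> configs" using x by (simp add: y_def configs_def alphabet_def Pi_iff)
    moreover have "cdist x y < 2 powr (- real m)"
      unfolding cdist_less_iff by (auto simp: y_def k_def)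
    moreover have "ring k y" "k \<ge> n" by (auto simp: ring_def y_def k_def)
    ultimately show ?thesis using m x by (auto simp: configs.in_mball)
  qed
  then show ?thesis unfolding configs.metric_closure_of by blast
qed

theorem proposition7:
  fixes Pz Pe :: int
  assumes "0 \<le> Pz" "Pz \<le> 9" "0 \<le> Pe" "Pe \<le> 9"
  shows "almost_equicontinuous (language_shift Pz Pe)"
  unfolding almost_equicontinuous_def
proof (intro exI conjI)
  \<comment> \<open>Lying in every member of this family means having rings of arbitrarily large
    radius.\<close>
  let ?U = "range (\<lambda>n. {x \<in> configs. \<exists>k\<ge>n. ring k x})"
  show "countable ?U" by simp
  show "\<forall>U\<in>?U. openin configs.mtopology U \<and> configs.mtopology closure_of U = configs"
    using openin_rings dense_rings by blast
  show "configs \<inter> \<Inter>?U \<subseteq> equicontinuity_points (language_shift Pz Pe)"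
    using rings_equicontinuity_point by blast
qed

end
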